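(* In the asymmetric bi-directional model, any set of $n$ points in the Euclidean plane can be strongly connected in $O(\log n)$ slots: there is a set of pairs forming a connected graph on the points that can be partitioned into $O(\log n)$ sets, each feasible in the asymmetric bi-directional model.
   Context: Bi-directional model: a pair $\ell=\{n_1,n_2\}$ of points defines two links $\ell_1=(n_1,n_2)$ and $\ell_2=(n_2,n_1)$, each of length $d(n_1,n_2)$; for links $x=(s,r)$, $y=(s',r')$ write $d_{xy}=d(s,r')$. Constants $\alpha>2$, $\beta\ge1$; noise is neglected. A set $L'$ of pairs is feasible in the asymmetric bi-directional model if there are powers $P_{\ell_1},P_{\ell_2}>0$ (possibly different) for each pair such that for every $\ell\in L'$ and $i\in\{1,2\}$: $\frac{P_{\ell_i}/\ell_i^\alpha}{\sum_{\ell'\in L'\setminus\{\ell\}}\sum_{k=1}^2P_{\ell'_k}/d_{\ell'_k\ell_i}^\alpha}\ge\beta$. Constants in $O(\cdot)$ may depend on $\alpha,\beta$. *)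

theory Defs
  imports
    "Graph_Theory.Digraph_Component"
    "HOL-Library.Landau_Symbols"
    "HOL-Library.Disjoint_Sets"
    "HOL-Analysis.Analysis"
begin

type_synonym point = "real ^ 2"

text \<open>A directed link is given as (sender, receiver).\<close>

type_synonym link = "point \<times> point"

definition pairs :: "point set \<Rightarrow> point set set" where
  "pairs V = {l. l \<subseteq> V \<and> card l = 2}"

definition links :: "point set \<Rightarrow> link set" where
  "links l = {(s, r). s \<noteq> r \<and> l = {s, r}}"

definition link_length :: "link \<Rightarrow> real" where
  "link_length x = dist (fst x) (snd x)"

definition link_dist :: "link \<Rightarrow> link \<Rightarrow> real" where
  "link_dist x y = dist (fst x) (snd y)"

text \<open>
  The ratios are taken in the extended nonnegative reals, where a positive number divided
  by \<open>0\<close> is \<open>\<infinity>\<close> and a finite number divided by \<open>\<infinity>\<close> is \<open>0\<close>. Hence a pair without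
  interferers satisfies the condition, and a sender placed at the receiver of another pair's
  link causes infinite interference, so that pairs sharing a point never fit in one slot.
  In type \<open>real\<close>, where division by \<open>0\<close> gives \<open>0\<close>, both cases would come out wrong.
\<close>

definition signal :: "real \<Rightarrow> (link \<Rightarrow> real) \<Rightarrow> link \<Rightarrow> ennreal" where
  "signal \<alpha> P x = ennreal (P x) / ennreal (link_length x powr \<alpha>)"

definition interference ::
    "real \<Rightarrow> (link \<Rightarrow> real) \<Rightarrow> point set set \<Rightarrow> link \<Rightarrow> ennreal" where
  "interference \<alpha> P L x =
     (\<Sum>l\<in>L. \<Sum>y\<in>links l. ennreal (P y) / ennreal (link_dist y x powr \<alpha>))"

definition feasible :: "real \<Rightarrow> real \<Rightarrow> point set set \<Rightarrow> bool" where
  "feasible \<alpha> \<beta> L \<longleftrightarrow> finite L \<and>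
     (\<exists>P. (\<forall>l\<in>L. \<forall>x\<in>links l. P x > 0) \<and>
          (\<forall>l\<in>L. \<forall>x\<in>links l. signal \<alpha> P x / interference \<alpha> P (L - {l}) x \<ge> ennreal \<beta>))"

text \<open>
  Both links of every pair are arcs, so this digraph is symmetric and its strong connectivity
  is connectivity of the graph on \<open>V\<close> with edge set \<open>L\<close>.
\<close>

definition link_graph :: "point set \<Rightarrow> point set set \<Rightarrow> (point, link) pre_digraph" where
  "link_graph V L = \<lparr>verts = V, arcs = (\<Union>l\<in>L. links l), tail = fst, head = snd\<rparr>"

definition connectable_in :: "real \<Rightarrow> real \<Rightarrow> point set \<Rightarrow> nat \<Rightarrow> bool" where
  "connectable_in \<alpha> \<beta> V k \<longleftrightarrow>
     (\<exists>L \<subseteq> pairs V. strongly_connected (link_graph V L) \<and>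
        (\<exists>\<P>. partition_on L \<P> \<and> card \<P> \<le> k \<and> (\<forall>S\<in>\<P>. feasible \<alpha> \<beta> S)))"

end

theory Submission
  imports Defs
begin

text \<open>
  It suffices to find, in every set of \<open>n \<ge> 2\<close> points, a feasible matching of at least \<open>\<kappa> n\<close> pairs:
  schedule it in one slot, drop one endpoint of each of its pairs and recurse.

  Balancing the symmetric matrix \<open>(d(u, v)\<^bsup>-\<alpha>\<^esup>)\<close> gives one power \<open>x\<^sub>v\<close> per point such that the matrix
  \<open>B(u, v) = x\<^sub>u x\<^sub>v / d(u, v)\<^bsup>\<alpha>\<^esup>\<close> has row sums at most \<open>1\<close>, and almost \<open>1\<close> in all but one row.
  Every entry is then at most \<open>1\<close>, that is \<open>r\<^sub>u r\<^sub>v \<le> d(u, v)\<^sup>2\<close> for \<open>r\<^sub>v = x\<^sub>v\<^bsup>2/\<alpha>\<^esup>\<close>, and since \<open>\<alpha> > 2\<close> a packing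
  argument shows that in each row the entries below a threshold \<open>\<delta>\<close> towards points with larger \<open>r\<close>
  sum up to at most \<open>1/16\<close>. Because \<open>B\<close> is symmetric, a constant fraction of the points must have an
  entry of at least \<open>\<delta>\<close>. At the receiver \<open>t\<close> of a link \<open>(s, t)\<close> whose sender uses the power \<open>x\<^sub>s\<close>, the ratio
  of signal to interference is \<open>B(s, t)\<close> divided by the sum of \<open>B(u, t)\<close> over the other senders \<open>u\<close>; so a
  subset of the pairs with \<open>B \<ge> \<delta>\<close> that is sparse with respect to \<open>B\<close> is feasible.
\<close>

subsection \<open>Packing\<close>

text \<open>Go through \<open>S\<close> in the order of \<open>D\<close> and charge each point to
  the one just before it. The charges go to distinct points, and only the first point, which has no
  predecessor, costs \<open>\<delta>\<close>.\<close>

lemma sum_le_sum_predecessors: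
  fixes f h D :: "'a \<Rightarrow> real"
  assumes "finite S" "0 \<le> \<delta>"
    and "\<And>z. z \<in> S \<Longrightarrow> f z \<le> \<delta>"
    and "\<And>z. z \<in> S \<Longrightarrow> 0 \<le> h z"
    and "\<And>z z'. \<lbrakk>z \<in> S; z' \<in> S; z \<noteq> z'; D z \<le> D z'\<rbrakk> \<Longrightarrow> f z' \<le> h z"
  shows "sum f S \<le> \<delta> + sum h S"
proof -
  \<comment> \<open>The point \<open>m\<close> keeps \<open>h m\<close> in reserve: the next point
    in the order is charged to it and becomes the new reserve.\<close>
  have "S \<noteq> {} \<longrightarrow> (\<exists>m\<in>S. sum f S \<le> \<delta> + sum h (S - {m}))"
    using assms
  proof (induction S rule: finite_ranking_induct[where f = D])
    case (insert x S)
    show ?case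
    proof (cases "S = {} \<or> x \<in> S")
      case True
      then show ?thesis
        using insert by (auto simp: insert_absorb)
    next
      case False
      then obtain m where m: "m \<in> S" "sum f S \<le> \<delta> + sum h (S - {m})"
        using insert by auto
      have "f x \<le> h m"
        using m(1) False insert.hyps(2) by (intro insert.prems(4)) auto
      moreover have "sum h S = h m + sum h (S - {m})"
        using m insert by (simp add: sum.remove)
      ultimately have "sum f (insert x S) \<le> \<delta> + sum h (insert x S - {x})"
        using m False insert by simp
      then show ?thesis
        by blast
    qed
  qed simp
  moreover have "sum h (S - {m}) \<le> sum h S" for m
    using assms by (intro sum_mono2) auto
  ultimately show ?thesis
    using assms by (cases "S = {}") (auto intro: order_trans)
qed

text \<open>The points are seen from a centre at the origin whose own parameter is normalised to \<open>1\<close>.\<close>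

locale spread_out =
  fixes Z :: "'a set" and g :: "'a \<Rightarrow> point" and r :: "'a \<Rightarrow> real"
  assumes fin: "finite Z"
    and r_ge_1: "z \<in> Z \<Longrightarrow> 1 \<le> r z"
    and r_le: "z \<in> Z \<Longrightarrow> r z \<le> (norm (g z))\<^sup>2"
    and r_mult_le: "\<lbrakk>z \<in> Z; z' \<in> Z; z \<noteq> z'\<rbrakk> \<Longrightarrow> r z * r z' \<le> (dist (g z) (g z'))\<^sup>2"
begin

lemma norm_ge_1:
  assumes "z \<in> Z" shows "1 \<le> norm (g z)"
proof -
  have "1\<^sup>2 \<le> (norm (g z))\<^sup>2"
    using r_ge_1[OF assms] r_le[OF assms] by simp
  then show ?thesis
    by (rule power2_le_imp_le) simp
qed

text \<open>Both factors of \<open>r z * r z'\<close> are at least 1, so each alone is at most the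
  squared distance. This makes the discs of radius \<open>sqrt (r z) / 2\<close> about the points
  disjoint.\<close>

lemma sqrt_add_sqrt_le_dist:
  assumes "z \<in> Z" "z' \<in> Z" "z \<noteq> z'"
  shows "sqrt (r z) / 2 + sqrt (r z') / 2 \<le> dist (g z) (g z')"
proof -
  have r: "1 \<le> r z" "1 \<le> r z'"
    using assms r_ge_1 by auto
  have "r z \<le> r z * r z'" "r z' \<le> r z * r z'"
    using r by simp_all
  then have "sqrt (r z) \<le> dist (g z) (g z')" "sqrt (r z') \<le> dist (g z) (g z')"
    using r_mult_le[OF assms] by (auto intro!: real_le_lsqrt)
  then show ?thesis
    by linarith
qed

text \<open>Area comparison: the disjoint discs of radius \<open>sqrt (r z) / 2\<close> lie in the
  disc of radius \<open>3 / 2 * \<rho>\<close>, because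
  \<open>sqrt (r z) \<le> norm (g z) \<le> \<rho>\<close>.\<close>

lemma sum_le_area:
  assumes "0 \<le> \<rho>"
  shows "(\<Sum>z | z \<in> Z \<and> norm (g z) \<le> \<rho>. r z) \<le> 9 * \<rho>\<^sup>2"
proof -
  define A where "A = {z \<in> Z. norm (g z) \<le> \<rho>}"
  define B where "B z = ball (g z) (sqrt (r z) / 2)" for z
  have finA: "finite A" and AZ: "A \<subseteq> Z"
    using fin by (auto simp: A_def)
  have measure_B: "measure lborel (B z) = r z / 4 * pi" if "z \<in> A" for z
    using that AZ r_ge_1[of z] by (auto simp: B_def circle_area power_divide)
  have disj: "disjoint_family_on B A"
    unfolding disjoint_family_on_def
  proof (intro ballI impI)
    fix z z' assume "z \<in> A" "z' \<in> A" "z \<noteq> z'"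
    then have "sqrt (r z) / 2 + sqrt (r z') / 2 \<le> dist (g z) (g z')"
      using AZ sqrt_add_sqrt_le_dist by blast
    then show "B z \<inter> B z' = {}"
      unfolding B_def by (rule disjoint_ballI)
  qed
  have sub: "(\<Union>z\<in>A. B z) \<subseteq> ball 0 (3 / 2 * \<rho>)"
  proof
    fix y assume "y \<in> (\<Union>z\<in>A. B z)"
    then obtain z where z: "z \<in> A" "dist (g z) y < sqrt (r z) / 2"
      by (auto simp: B_def)
    have "sqrt (r z) \<le> norm (g z)"
      using z AZ r_le[of z] by (auto intro!: real_le_lsqrt)
    moreover have "norm (g z) \<le> \<rho>"
      using z by (simp add: A_def)
    moreover have "norm y \<le> norm (g z) + dist (g z) y"
      by (metis add.commute dist_norm norm_triangle_sub dist_commute)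
    ultimately show "y \<in> ball 0 (3 / 2 * \<rho>)"
      using z(2) by simp
  qed
  have ball: "ball (0::point) (3 / 2 * \<rho>) \<in> fmeasurable lborel"
    by (rule fmeasurableI[OF _ emeasure_lborel_ball_finite]) simp
  have "(\<Sum>z\<in>A. r z / 4 * pi) = (\<Sum>z\<in>A. measure lborel (B z))"
    by (rule sum.cong) (simp_all add: measure_B)
  also have "\<dots> = measure lborel (\<Union>z\<in>A. B z)"
  proof (rule measure_finite_Union[symmetric, OF finA _ disj])
    show "emeasure lborel (B z) \<noteq> \<infinity>" if "z \<in> A" for z
      using emeasure_lborel_ball_finite[of "g z" "sqrt (r z) / 2"] by (simp add: B_def less_top)
  qed (auto simp: B_def)
  also have "\<dots> \<le> measure lborel (ball (0::point) (3 / 2 * \<rho>))"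
    using finA ball by (intro measure_mono_fmeasurable[OF sub]) (auto simp: B_def intro: sets.finite_UN)
  also have "\<dots> = (3 / 2 * \<rho>)\<^sup>2 * pi"
    using assms by (simp add: circle_area)
  finally have "(\<Sum>z\<in>A. r z) * (pi / 4) \<le> 9 * \<rho>\<^sup>2 * (pi / 4)"
    by (simp flip: sum_distrib_right sum_divide_distrib add: power_mult_distrib power_divide)
  then show ?thesis
    unfolding A_def by simp
qed

text \<open>Dyadic shells: for norms between \<open>\<rho>\<close> and \<open>2 * \<rho>\<close> the
  values \<open>r z\<close> sum to at most \<open>9 * (2 * \<rho>)^2\<close>, so the shell
  contributes at most \<open>36 * \<rho> powr (1 - \<gamma>)\<close>. Over
  \<open>\<rho> = 2^j * R\<close> this is a geometric series, with ratio below 1 because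
  \<open>\<gamma> > 1\<close>.\<close>

lemma sum_shells_le:
  assumes "1 < \<gamma>" "1 \<le> R"
  shows "(\<Sum>z | z \<in> Z \<and> R \<le> norm (g z). r z / norm (g z) powr (1 + \<gamma>))
           \<le> 36 * R powr (1 - \<gamma>) / (1 - 2 powr (1 - \<gamma>))"
proof -
  define q where "q = 2 powr (1 - \<gamma>)"
  define f where "f z = r z / norm (g z) powr (1 + \<gamma>)" for z
  have q: "0 < q" "q < 1"
    using assms by (auto simp: q_def powr_less_one)
  have f0: "0 \<le> f z" if "z \<in> Z" for z
    using r_ge_1[OF that] by (simp add: f_def)
  have shell: "(\<Sum>z | z \<in> Z \<and> 2^j * R \<le> norm (g z) \<and> norm (g z) < 2 * (2^j * R). f z)
                 \<le> 36 * R powr (1 - \<gamma>) * q^j" (is "sum f ?S \<le> _") for j :: nat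
  proof -
    define \<rho> where "\<rho> = 2^j * R"
    have \<rho>: "0 < \<rho>"
      using assms by (simp add: \<rho>_def)
    have "sum f ?S \<le> (\<Sum>z\<in>?S. r z / \<rho> powr (1 + \<gamma>))"
    proof (rule sum_mono)
      fix z assume z: "z \<in> ?S"
      then have "\<rho> powr (1 + \<gamma>) \<le> norm (g z) powr (1 + \<gamma>)"
        using \<rho> assms by (intro powr_mono2) (auto simp: \<rho>_def)
      then show "f z \<le> r z / \<rho> powr (1 + \<gamma>)"
        unfolding f_def using \<rho> z r_ge_1[of z] by (intro divide_left_mono) (auto intro!: mult_pos_pos)
    qed
    also have "\<dots> \<le> (\<Sum>z | z \<in> Z \<and> norm (g z) \<le> 2 * \<rho>. r z / \<rho> powr (1 + \<gamma>))"
      using fin r_ge_1 by (intro sum_mono2) (force simp: \<rho>_def)+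
    also have "\<dots> = (\<Sum>z | z \<in> Z \<and> norm (g z) \<le> 2 * \<rho>. r z) / \<rho> powr (1 + \<gamma>)"
      by (simp add: sum_divide_distrib)
    also have "\<dots> \<le> 9 * (2 * \<rho>)\<^sup>2 / \<rho> powr (1 + \<gamma>)"
      using \<rho> by (intro divide_right_mono sum_le_area) auto
    also have "\<dots> = 36 * (\<rho> powr 2 / \<rho> powr (1 + \<gamma>))"
      using \<rho> by (simp add: power_mult_distrib)
    also have "\<dots> = 36 * \<rho> powr (1 - \<gamma>)"
      by (simp add: powr_diff[symmetric])
    also have "\<rho> powr (1 - \<gamma>) = R powr (1 - \<gamma>) * q^j"
      using assms by (simp add: \<rho>_def q_def powr_mult powr_realpow[symmetric] powr_powr mult.commute)
    finally show ?thesis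
      by simp
  qed
  have upto: "(\<Sum>z | z \<in> Z \<and> R \<le> norm (g z) \<and> norm (g z) < 2^J * R. f z)
                \<le> 36 * R powr (1 - \<gamma>) * (\<Sum>j<J. q^j)" for J
  proof (induction J)
    case 0
    then show ?case by (simp add: leD cong: conj_cong)
  next
    case (Suc J)
    let ?A = "{z. z \<in> Z \<and> R \<le> norm (g z) \<and> norm (g z) < 2^J * R}"
    let ?B = "{z. z \<in> Z \<and> 2^J * R \<le> norm (g z) \<and> norm (g z) < 2 * (2^J * R)}"
    have "1 * R \<le> 2^J * R"
      using assms by (intro mult_right_mono) auto
    then have "R \<le> norm (g z)" if "2^J * R \<le> norm (g z)" for z
      using that by linarith
    then have "{z. z \<in> Z \<and> R \<le> norm (g z) \<and> norm (g z) < 2^Suc J * R} = ?A \<union> ?B"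
      using assms by (auto simp: mult.assoc)
    then have "(\<Sum>z | z \<in> Z \<and> R \<le> norm (g z) \<and> norm (g z) < 2^Suc J * R. f z) = sum f ?A + sum f ?B"
      using fin by (auto intro: sum.union_disjoint)
    also have "\<dots> \<le> 36 * R powr (1 - \<gamma>) * (\<Sum>j<J. q^j) + 36 * R powr (1 - \<gamma>) * q^J"
      using Suc shell by (rule add_mono)
    finally show ?case
      by (simp add: algebra_simps)
  qed
  \<comment> \<open>Since \<open>Z\<close> is finite, finitely many shells exhaust it, and the
    geometric sum is bounded independently of their number \<open>J\<close>.\<close>
  obtain M where M: "\<And>z. z \<in> Z \<Longrightarrow> norm (g z) \<le> M"
    using finite_imp_bounded[OF finite_imageI[OF fin, of g]] by (auto simp: bounded_iff)
  obtain J where J: "M < 2^J"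
    using real_arch_pow[of 2 M] by auto
  have "norm (g z) < 2^J * R" if "z \<in> Z" for z
  proof -
    have "norm (g z) < 2^J * 1"
      using M[OF that] J by simp
    also have "\<dots> \<le> 2^J * R"
      using assms by (intro mult_left_mono) auto
    finally show ?thesis .
  qed
  then have "(\<Sum>z | z \<in> Z \<and> R \<le> norm (g z). f z)
               = (\<Sum>z | z \<in> Z \<and> R \<le> norm (g z) \<and> norm (g z) < 2^J * R. f z)"
    by (intro sum.cong) auto
  also have "\<dots> \<le> 36 * R powr (1 - \<gamma>) * (\<Sum>j<J. q^j)"
    by (rule upto)
  also have "\<dots> \<le> 36 * R powr (1 - \<gamma>) * (1 / (1 - q))"
  proof (rule mult_left_mono)
    show "(\<Sum>j<J. q^j) \<le> 1 / (1 - q)"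
      using q by (simp add: sum_gp_strict divide_right_mono)
  qed simp
  finally show ?thesis
    by (simp add: f_def q_def)
qed

text \<open>The cut-off \<open>R\<close> separates two effects: points closer than \<open>R\<close>
  are controlled by area and cost a multiple of \<open>\<delta>\<close>, while farther points cost a
  shell tail that decays in \<open>R\<close>, plus a single extra \<open>\<delta>\<close>.\<close>

lemma sum_small_terms_le:
  assumes "1 < \<gamma>" "1 \<le> R" "0 \<le> \<delta>"
  defines "f \<equiv> \<lambda>z. (r z / (norm (g z))\<^sup>2) powr \<gamma>"
  shows "(\<Sum>z | z \<in> Z \<and> f z < \<delta>. f z)
           \<le> (9 * R\<^sup>2 + 1) * \<delta> + (1 + 4 powr \<gamma>) * (36 * R powr (1 - \<gamma>) / (1 - 2 powr (1 - \<gamma>)))"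
proof -
  define h where "h z = r z / norm (g z) powr (1 + \<gamma>)" for z
  \<comment> \<open>Light terms are at most \<open>h\<close>. If \<open>z\<close> is heavy and \<open>z'\<close> is farther away, then \<open>r_mult_le\<close> bounds the
    term of \<open>z'\<close> by a multiple of \<open>h z\<close>, so only the nearest heavy term needs the bound \<open>\<delta>\<close>.\<close>
  define near where "near = {z \<in> Z. f z < \<delta> \<and> norm (g z) < R}"
  define far where "far = {z \<in> Z. R \<le> norm (g z)}"
  define light where "light = {z \<in> far. f z < \<delta> \<and> r z \<le> norm (g z)}"
  define heavy where "heavy = {z \<in> far. f z < \<delta> \<and> norm (g z) < r z}"
  note sets_defs = near_def far_def light_def heavy_def
  have fins: "finite near" "finite far" "finite light" "finite heavy"
    using fin by (auto simp: sets_defs)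
  have h0: "0 \<le> h z" if "z \<in> Z" for z
    using r_ge_1[OF that] by (simp add: h_def)
  have far: "sum h far \<le> 36 * R powr (1 - \<gamma>) / (1 - 2 powr (1 - \<gamma>))"
    unfolding h_def far_def using sum_shells_le assms by blast
  \<comment> \<open>As \<open>r z\<close> is at least 1, a term below \<open>\<delta>\<close> is at
    most \<open>\<delta> * r z\<close>, and the area bound applies.\<close>
  have "sum f near \<le> (\<Sum>z\<in>near. \<delta> * r z)"
  proof (rule sum_mono)
    fix z assume z: "z \<in> near"
    then have "\<delta> * 1 \<le> \<delta> * r z"
      using assms r_ge_1[of z] by (intro mult_left_mono) (auto simp: near_def)
    then show "f z \<le> \<delta> * r z"
      using z by (simp add: near_def)
  qed
  also have "\<dots> \<le> \<delta> * (\<Sum>z | z \<in> Z \<and> norm (g z) \<le> R. r z)"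
    unfolding sum_distrib_left
    using fin assms by (intro sum_mono2) (auto simp: near_def dest: r_ge_1)
  also have "\<dots> \<le> \<delta> * (9 * R\<^sup>2)"
    using assms by (intro mult_left_mono sum_le_area) auto
  finally have near: "sum f near \<le> \<delta> * (9 * R\<^sup>2)" .
  have "sum f light \<le> sum h light"
  proof (rule sum_mono)
    fix z assume "z \<in> light"
    then have z: "z \<in> Z" "r z \<le> norm (g z)"
      by (auto simp: sets_defs)
    define D where "D = norm (g z)"
    have r: "1 \<le> r z" "r z \<le> D"
      using z r_ge_1 by (auto simp: D_def)
    have "f z = r z powr \<gamma> / D powr (2 * \<gamma>)"
      using r by (simp add: f_def D_def[symmetric] powr_divide powr_powr powr_numeral[symmetric] del: powr_numeral)
    also have "r z powr \<gamma> = r z * r z powr (\<gamma> - 1)"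
      using r by (simp add: powr_diff)
    also have "\<dots> \<le> r z * D powr (\<gamma> - 1)"
      using r assms by (intro mult_left_mono powr_mono2) auto
    also have "r z * D powr (\<gamma> - 1) / D powr (2 * \<gamma>) = r z * (D powr (\<gamma> - 1) / D powr (2 * \<gamma>))"
      by simp
    also have "D powr (\<gamma> - 1) / D powr (2 * \<gamma>) = D powr (- (1 + \<gamma>))"
      by (simp add: powr_diff[symmetric] algebra_simps)
    also have "r z * \<dots> = h z"
      by (simp only: h_def D_def powr_minus divide_inverse)
    finally show "f z \<le> h z"
      by (simp add: divide_right_mono)
  qed
  also have "\<dots> \<le> sum h far"
    using fins h0 by (intro sum_mono2) (auto simp: sets_defs)
  finally have light: "sum f light \<le> sum h far" .
  have "sum f heavy \<le> \<delta> + (\<Sum>z\<in>heavy. 4 powr \<gamma> * h z)"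
  proof (rule sum_le_sum_predecessors[where D = "\<lambda>z. norm (g z)"])
    fix z z' assume z: "z \<in> heavy" "z' \<in> heavy" "z \<noteq> z'" and le: "norm (g z) \<le> norm (g z')"
    define D D' where "D = norm (g z)" and "D' = norm (g z')"
    have D: "1 \<le> D" "D \<le> D'" "D < r z" "1 \<le> r z'"
      using z le norm_ge_1 r_ge_1 by (auto simp: sets_defs D_def D'_def)
    \<comment> \<open>Heaviness \<open>D < r z\<close> is used twice: here to put \<open>D\<close>
      in place of \<open>r z\<close>, and at the end to return from
      \<open>D / D powr (1 + \<gamma>)\<close> to \<open>h z\<close>.\<close>
    have "D * r z' \<le> r z * r z'"
      using D by simp
    also have "\<dots> \<le> (dist (g z) (g z'))\<^sup>2"
      using z r_mult_le by (auto simp: sets_defs)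
    also have "\<dots> \<le> (2 * D')\<^sup>2"
      using norm_triangle_ineq4[of "g z" "g z'"] le
      by (intro power_mono) (auto simp: dist_norm D'_def)
    finally have "r z' / D'\<^sup>2 \<le> 4 / D"
      using D by (simp add: field_simps power_mult_distrib)
    then have "f z' \<le> (4 / D) powr \<gamma>"
      unfolding f_def D'_def using assms D by (intro powr_mono2) auto
    also have "\<dots> = 4 powr \<gamma> * (1 / D powr \<gamma>)"
      using D by (simp add: powr_divide)
    also have "1 / D powr \<gamma> = D / D powr (1 + \<gamma>)"
      using D by (simp add: powr_add)
    also have "\<dots> \<le> h z"
      unfolding h_def D_def[symmetric] using D by (intro divide_right_mono) auto
    finally show "f z' \<le> 4 powr \<gamma> * h z"
      by simp
  qed (use assms fins h0 in \<open>auto simp: sets_defs\<close>)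
  also have "(\<Sum>z\<in>heavy. 4 powr \<gamma> * h z) \<le> (\<Sum>z\<in>far. 4 powr \<gamma> * h z)"
    using fins h0 by (intro sum_mono2) (auto simp: sets_defs)
  finally have heavy: "sum f heavy \<le> \<delta> + 4 powr \<gamma> * sum h far"
    by (simp add: sum_distrib_left)
  have "{z. z \<in> Z \<and> f z < \<delta>} = near \<union> (light \<union> heavy)"
    by (auto simp: sets_defs)
  moreover have "sum f (near \<union> (light \<union> heavy)) = sum f near + (sum f light + sum f heavy)"
    by (subst sum.union_disjoint, use fins in \<open>auto simp: sets_defs\<close>)+
  ultimately have "(\<Sum>z | z \<in> Z \<and> f z < \<delta>. f z) \<le> (9 * R\<^sup>2 + 1) * \<delta> + (1 + 4 powr \<gamma>) * sum h far"
    using near light heavy by (simp add: algebra_simps)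
  also have "\<dots> \<le> (9 * R\<^sup>2 + 1) * \<delta> + (1 + 4 powr \<gamma>) * (36 * R powr (1 - \<gamma>) / (1 - 2 powr (1 - \<gamma>)))"
    using far by (intro add_left_mono mult_left_mono) auto
  finally show ?thesis .
qed

end

text \<open>Choose \<open>R\<close> first, so large that the tail is below
  \<open>\<eta> / 2\<close>, and then \<open>\<delta>\<close> so small that the remaining part is
  too. Neither choice depends on \<open>Z\<close>, which is why the final constants are independent
  of the number of points.\<close>

lemma small_terms_threshold:
  fixes \<gamma> \<eta> :: real
  assumes "1 < \<gamma>" "0 < \<eta>"
  obtains \<delta> where "0 < \<delta>" "\<delta> < 1"
    and "\<And>(Z :: 'a set) g r. spread_out Z g r \<Longrightarrow>
           (\<Sum>z | z \<in> Z \<and> (r z / (norm (g z))\<^sup>2) powr \<gamma> < \<delta>. (r z / (norm (g z))\<^sup>2) powr \<gamma>) \<le> \<eta>"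
proof -
  define C where "C = (1 + 4 powr \<gamma>) * (36 / (1 - 2 powr (1 - \<gamma>)))"
  have "((\<lambda>R. C * R powr (1 - \<gamma>)) \<longlongrightarrow> C * 0) at_top"
    using assms by (intro tendsto_mult tendsto_const tendsto_neg_powr filterlim_ident) auto
  then have "eventually (\<lambda>R. C * R powr (1 - \<gamma>) < \<eta> / 2) at_top"
    using assms by (intro order_tendstoD(2)[where y = "C * 0"]) auto
  then have "eventually (\<lambda>R. C * R powr (1 - \<gamma>) < \<eta> / 2 \<and> 1 \<le> R) at_top"
    by (intro eventually_conj eventually_ge_at_top)
  then obtain R where R: "C * R powr (1 - \<gamma>) < \<eta> / 2" "1 \<le> R"
    using eventually_happens'[OF trivial_limit_at_top_linorder] by blast
  define \<delta> where "\<delta> = min (1 / 2) (\<eta> / (2 * (9 * R\<^sup>2 + 1)))"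
  have pos: "0 < 9 * R\<^sup>2 + 1"
    by (simp add: add_nonneg_pos)
  show thesis
  proof
    show "0 < \<delta>" "\<delta> < 1"
      using assms pos by (auto simp: \<delta>_def)
    fix Z :: "'a set" and g :: "'a \<Rightarrow> point" and r :: "'a \<Rightarrow> real"
    assume "spread_out Z g r"
    from spread_out.sum_small_terms_le[OF this assms(1) R(2), of \<delta>]
    have "(\<Sum>z | z \<in> Z \<and> (r z / (norm (g z))\<^sup>2) powr \<gamma> < \<delta>. (r z / (norm (g z))\<^sup>2) powr \<gamma>)
            \<le> (9 * R\<^sup>2 + 1) * \<delta> + C * R powr (1 - \<gamma>)"
      using \<open>0 < \<delta>\<close> by (simp add: C_def mult_ac)
    also have "(9 * R\<^sup>2 + 1) * \<delta> \<le> (9 * R\<^sup>2 + 1) * (\<eta> / (2 * (9 * R\<^sup>2 + 1)))"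
      using pos by (intro mult_left_mono) (auto simp: \<delta>_def)
    also have "\<dots> = \<eta> / 2"
      using pos by (simp add: field_simps)
    finally show "(\<Sum>z | z \<in> Z \<and> (r z / (norm (g z))\<^sup>2) powr \<gamma> < \<delta>. (r z / (norm (g z))\<^sup>2) powr \<gamma>) \<le> \<eta>"
      using R by simp
  qed
qed

subsection \<open>Balancing\<close>

text \<open>A symmetric diagonal scaling of \<open>c\<close> to row sums 1, found as a minimiser.
  The slack \<open>\<theta> * x v\<close> keeps the equations solvable for every admissible
  \<open>c\<close>, even \<open>c = 0\<close>.\<close>

lemma balance:
  fixes c :: "'a \<Rightarrow> 'a \<Rightarrow> real" and V :: "'a set" and \<theta> :: real
  assumes fin: "finite V" and "0 < \<theta>"
    and c_nonneg: "\<And>u v. 0 \<le> c u v" and c_sym: "\<And>u v. c u v = c v u"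
  obtains x where "\<And>v. 0 < x v"
    and "\<And>v. v \<in> V \<Longrightarrow> \<theta> * x v + (\<Sum>u\<in>V - {v}. c v u * x v * x u) = 1"
proof -
  \<comment> \<open>The linear terms make \<open>F\<close> coercive for every \<open>V\<close>; stationarity of \<open>F\<close> in the
    coordinate \<open>v\<close> is the balance equation at \<open>v\<close>.\<close>
  define F where "F x = (\<Sum>v\<in>V. \<Sum>u\<in>V - {v}. c v u * x v * x u) / 2 + (\<Sum>v\<in>V. \<theta> * x v - ln (x v))"
    for x :: "'a \<Rightarrow> real"
  \<comment> \<open>If \<open>F x\<close> is at most the value of \<open>F\<close> at the constant
    1, then \<open>\<theta> * x v - ln (x v) \<le> M\<close> for each \<open>v\<close> in
    \<open>V\<close>: the interaction sum is nonnegative, and each of the other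
    \<open>card V - 1\<close> terms is at least \<open>1 + ln \<theta>\<close>, the minimum of
    \<open>\<theta> * t - ln t\<close>. This confines \<open>x v\<close> to the interval from
    \<open>a\<close> to \<open>b\<close>; for \<open>b\<close>, half of the linear term absorbs the
    logarithm.\<close>
  define M where "M = F (\<lambda>_. 1) - (real (card V) - 1) * (1 + ln \<theta>)"
  define a where "a = exp (- M)"
  define b where "b = (M - 1 - ln (\<theta> / 2)) / (\<theta> / 2)"
  \<comment> \<open>Coordinates outside \<open>V\<close> are pinned to 1, so \<open>K\<close> is a
    product of compact sets in the whole function space and Tychonoff's theorem applies.\<close>
  define K where "K = PiE UNIV (\<lambda>v. if v \<in> V then {a..b} else {1::real})"
  have ln_le: "ln t \<le> s * t - 1 - ln s" if "0 < s" "0 < t" for s t :: real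
    using ln_le_minus_one[of "s * t"] that by (simp add: ln_mult)
  have in_box: "a \<le> x v \<and> x v \<le> b" if v: "v \<in> V" and pos: "\<And>u. 0 < x u" and le: "F x \<le> F (\<lambda>_. 1)" for x v
  proof -
    have "0 \<le> (\<Sum>v\<in>V. \<Sum>u\<in>V - {v}. c v u * x v * x u)"
      using c_nonneg pos by (intro sum_nonneg mult_nonneg_nonneg) (auto intro: less_imp_le)
    then have "(\<Sum>u\<in>V. \<theta> * x u - ln (x u)) \<le> F x"
      by (simp add: F_def)
    moreover have "(real (card V) - 1) * (1 + ln \<theta>) \<le> (\<Sum>u\<in>V - {v}. \<theta> * x u - ln (x u))"
    proof -
      have "real (card (V - {v})) * (1 + ln \<theta>) \<le> (\<Sum>u\<in>V - {v}. \<theta> * x u - ln (x u))"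
        using ln_le[OF \<open>0 < \<theta>\<close> pos] by (intro sum_bounded_below) (smt (verit))
      moreover have "real (card (V - {v})) = real (card V) - 1"
        using v fin by (simp add: of_nat_diff Suc_leI card_gt_0_iff) (metis One_nat_def Suc_leI card_gt_0_iff empty_iff of_nat_1 of_nat_diff)
      ultimately show ?thesis
        by simp
    qed
    moreover have "(\<Sum>u\<in>V. \<theta> * x u - ln (x u)) = \<theta> * x v - ln (x v) + (\<Sum>u\<in>V - {v}. \<theta> * x u - ln (x u))"
      using v fin by (rule sum.remove[rotated])
    ultimately have *: "\<theta> * x v - ln (x v) \<le> M"
      using le by (simp add: M_def)
    have "0 < \<theta> * x v"
      using \<open>0 < \<theta>\<close> pos by simp
    with * have "- M \<le> ln (x v)"
      by linarith
    then have "a \<le> x v"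
      using pos[of v] by (simp add: a_def ln_ge_iff)
    moreover have "\<theta> / 2 * x v \<le> M - 1 - ln (\<theta> / 2)"
      using * ln_le[of "\<theta> / 2" "x v"] \<open>0 < \<theta>\<close> pos by simp
    then have "x v \<le> b"
      using \<open>0 < \<theta>\<close> by (simp add: b_def pos_le_divide_eq mult.commute)
    ultimately show ?thesis
      by simp
  qed
  have K: "x \<in> K \<longleftrightarrow> (\<forall>v. (v \<in> V \<longrightarrow> a \<le> x v \<and> x v \<le> b) \<and> (v \<notin> V \<longrightarrow> x v = 1))" for x
    by (auto simp: K_def PiE_iff split: if_splits)
  have K_pos: "0 < x v" if "x \<in> K" for x v
  proof -
    have "0 < a"
      by (simp add: a_def)
    moreover have "a \<le> x v \<or> x v = 1"
      using that K by blast
    ultimately show ?thesis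
      by linarith
  qed
  then have K_nz: "x v \<noteq> 0" if "x \<in> K" for x v
    using that by (metis less_irrefl)
  have one: "(\<lambda>_. 1) \<in> K"
    unfolding K using in_box[of _ "\<lambda>_. 1"] by auto
  have "compact K"
  proof -
    have "compactin (product_topology (\<lambda>_. euclidean) UNIV) K"
      unfolding K_def by (auto simp: compactin_PiE)
    then show ?thesis
      by (simp add: euclidean_product_topology)
  qed
  moreover have "continuous_on K F"
    unfolding F_def
    by (intro continuous_intros continuous_on_subset[OF continuous_on_product_coordinates])
       (use K_nz in auto)
  ultimately obtain x where x: "x \<in> K" and x_min: "\<And>y. y \<in> K \<Longrightarrow> F x \<le> F y"
    using continuous_attains_inf[of K F] one by blast
  show thesis
  proof
    show pos: "0 < x v" for v
      by (rule K_pos[OF x])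
    fix v assume v: "v \<in> V"
    define A where "A = \<theta> + (\<Sum>u\<in>V - {v}. c v u * x u)"
    define G where "G = (\<Sum>w\<in>V - {v}. \<Sum>u\<in>V - {w} - {v}. c w u * x w * x u) / 2 + (\<Sum>w\<in>V - {v}. \<theta> * x w - ln (x w))"
    \<comment> \<open>Since \<open>c\<close> is symmetric, the products involving \<open>v\<close>
      occur twice and cancel the factor 1/2. What remains in the coordinate \<open>t\<close> is
      \<open>A * t - ln t\<close>, minimal at \<open>1 / A\<close>.\<close>
    have F_upd: "F (x(v := t)) = A * t - ln t + G" for t
    proof -
      let ?y = "x(v := t)"
      have "(\<Sum>w\<in>V. \<Sum>u\<in>V - {w}. c w u * ?y w * ?y u)
              = (\<Sum>u\<in>V - {v}. c v u * t * x u) + (\<Sum>w\<in>V - {v}. \<Sum>u\<in>V - {w}. c w u * x w * ?y u)"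
        using fin v by (auto simp: sum.remove[of V v] intro!: arg_cong2[where f = "(+)"] sum.cong)
      also have "(\<Sum>w\<in>V - {v}. \<Sum>u\<in>V - {w}. c w u * x w * ?y u)
                   = (\<Sum>w\<in>V - {v}. c v w * t * x w + (\<Sum>u\<in>V - {w} - {v}. c w u * x w * x u))"
      proof (rule sum.cong)
        fix w assume "w \<in> V - {v}"
        then have "(\<Sum>u\<in>V - {w}. c w u * x w * ?y u)
                     = c w v * x w * t + (\<Sum>u\<in>V - {w} - {v}. c w u * x w * x u)"
          using fin v by (subst sum.remove[of _ v]) auto
        then show "(\<Sum>u\<in>V - {w}. c w u * x w * ?y u)
                     = c v w * t * x w + (\<Sum>u\<in>V - {w} - {v}. c w u * x w * x u)"
          by (simp add: c_sym[of w v] mult_ac)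
      qed simp
      moreover have "(\<Sum>w\<in>V. \<theta> * ?y w - ln (?y w)) = \<theta> * t - ln t + (\<Sum>w\<in>V - {v}. \<theta> * x w - ln (x w))"
        using fin v by (auto simp: sum.remove[of V v] intro!: arg_cong2[where f = "(+)"] sum.cong)
      moreover have "(\<Sum>u\<in>V - {v}. c v u * t * x u) = (\<Sum>u\<in>V - {v}. c v u * x u) * t"
        by (simp add: sum_distrib_left sum_distrib_right mult_ac)
      ultimately show ?thesis
        by (simp add: F_def A_def G_def sum.distrib algebra_simps add_divide_distrib)
    qed
    have "0 \<le> (\<Sum>u\<in>V - {v}. c v u * x u)"
      using c_nonneg pos by (intro sum_nonneg mult_nonneg_nonneg) (auto intro: less_imp_le)
    then have A: "0 < A"
      using \<open>0 < \<theta>\<close> by (simp add: A_def)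
    \<comment> \<open>Comparing with this competitor replaces differentiation. If \<open>F y\<close>
      exceeds the value at the constant 1, the comparison is trivial, because that constant lies in
      \<open>K\<close>; otherwise \<open>y\<close> itself lies in \<open>K\<close>.\<close>
    define y where "y = x(v := 1 / A)"
    have "F x \<le> F y"
    proof (cases "F y \<le> F (\<lambda>_. 1)")
      case True
      have "\<And>u. 0 < y u"
        using pos A by (simp add: y_def)
      then have "a \<le> y u \<and> y u \<le> b" if "u \<in> V" for u
        using in_box[OF that, of y] True by blast
      moreover have "y u = 1" if "u \<notin> V" for u
        using x v that unfolding K by (auto simp: y_def)
      ultimately have "y \<in> K"
        unfolding K by blast
      then show ?thesis
        by (rule x_min)
    next
      case False
      then show ?thesis
        using x_min[OF one] by simp
    qed
    then have "A * x v - ln (x v) \<le> 1 + ln A"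
      using F_upd[of "x v"] F_upd[of "1 / A"] A by (simp add: y_def ln_div)
    \<comment> \<open>This reverses the inequality \<open>ln t \<le> t - 1\<close>, where equality
      holds only at \<open>t = 1\<close>.\<close>
    then have "A * x v - 1 \<le> ln (A * x v)"
      using A pos[of v] by (simp add: ln_mult)
    then have "A * x v = 1"
      using A pos[of v] ln_le_minus_one[of "A * x v"] by (intro ln_eq_minus_one) (auto intro: antisym)
    moreover have "\<theta> * x v + (\<Sum>u\<in>V - {v}. c v u * x v * x u) = A * x v"
      by (simp add: A_def distrib_left sum_distrib_left mult_ac)
    ultimately show "\<theta> * x v + (\<Sum>u\<in>V - {v}. c v u * x v * x u) = 1"
      by simp
  qed
qed

section \<open>Couplings and strongly coupled points\<close>

text \<open>Up to the factor \<open>x v\<close> this is the power received at \<open>v\<close> from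
  a sender \<open>u\<close> of power \<open>x u\<close>; the extra factor makes the matrix symmetric
  and cancels in ratios at a fixed receiver.\<close>

definition coupling :: "real \<Rightarrow> (point \<Rightarrow> real) \<Rightarrow> point \<Rightarrow> point \<Rightarrow> real" where
  "coupling \<alpha> x u v = x u * x v / dist u v powr \<alpha>"

text \<open>Here \<open>0 powr \<alpha>\<close> and division by 0 both yield 0, so row sums may run
  over all of \<open>V\<close>.\<close>

lemma coupling_self [simp]: "coupling \<alpha> x u u = 0"
  by (simp add: coupling_def)

lemma coupling_commute: "coupling \<alpha> x u v = coupling \<alpha> x v u"
  by (simp add: coupling_def dist_commute mult.commute)

lemma coupling_nonneg: "(\<And>v. 0 < x v) \<Longrightarrow> 0 \<le> coupling \<alpha> x u v"
  by (simp add: coupling_def less_imp_le)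

lemma norm_rescaled:
  fixes w z :: "'a :: real_normed_vector"
  assumes "0 < s"
  shows "norm ((z - w) /\<^sub>R s) = dist w z / s"
  using assms by (simp add: dist_norm norm_minus_commute divide_inverse_commute)

text \<open>Moving \<open>w\<close> to the origin and scaling lengths and \<open>r\<close> by
  \<open>1 / r w\<close> preserves the product condition, as both sides are quadratic. Restricting
  to points with \<open>r w \<le> r z\<close> provides the normalisation by 1.\<close>

lemma spread_out_rescaled:
  fixes V :: "point set" and r :: "point \<Rightarrow> real"
  assumes "finite V" "w \<in> V" and r_pos: "\<And>v. 0 < r v"
    and le: "\<And>u v. \<lbrakk>u \<in> V; v \<in> V; u \<noteq> v\<rbrakk> \<Longrightarrow> r u * r v \<le> (dist u v)\<^sup>2"
  shows "spread_out {z \<in> V - {w}. r w \<le> r z} (\<lambda>z. (z - w) /\<^sub>R r w) (\<lambda>z. r z / r w)"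
proof
  fix z z' assume z: "z \<in> {z \<in> V - {w}. r w \<le> r z}" "z' \<in> {z \<in> V - {w}. r w \<le> r z}" "z \<noteq> z'"
  have "dist ((z - w) /\<^sub>R r w) ((z' - w) /\<^sub>R r w) = dist z z' / r w"
    using r_pos[of w] by (simp add: dist_norm scaleR_diff_right[symmetric] divide_inverse_commute)
  then show "r z / r w * (r z' / r w) \<le> (dist ((z - w) /\<^sub>R r w) ((z' - w) /\<^sub>R r w))\<^sup>2"
    using z le[of z z'] r_pos[of w] by (simp add: power_divide power2_eq_square divide_right_mono)
next
  fix z assume z: "z \<in> {z \<in> V - {w}. r w \<le> r z}"
  then have "r w * r z \<le> (dist w z)\<^sup>2"
    using le[of w z] \<open>w \<in> V\<close> by auto
  then show "r z / r w \<le> (norm ((z - w) /\<^sub>R r w))\<^sup>2"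
    unfolding norm_rescaled[OF r_pos]
    using r_pos[of w]
    by (simp add: mult.commute power_divide power2_eq_square divide_simps)
  show "1 \<le> r z / r w"
    using z r_pos[of w] by simp
qed (use assms in auto)

text \<open>The entries below \<open>\<delta>\<close> have a small total, but a point without a
  strong partner and with little slack has almost its whole row sum in such entries. So there are
  few of these points.\<close>

lemma many_strongly_coupled:
  fixes \<alpha> :: real
  assumes "2 < \<alpha>"
  obtains \<delta> where "0 < \<delta>" "\<delta> < 1"
    and "\<And>V. \<lbrakk>finite V; 2 \<le> card V\<rbrakk> \<Longrightarrow> \<exists>x. (\<forall>v. 0 < x v) \<and>
           (\<forall>v\<in>V. (\<Sum>u\<in>V. coupling \<alpha> x v u) \<le> 1) \<and>
           real (card V) / 3 \<le> real (card {v \<in> V. \<exists>u\<in>V. \<delta> \<le> coupling \<alpha> x v u})"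
proof -
  obtain \<delta> where \<delta>: "0 < \<delta>" "\<delta> < 1"
    and small: "\<And>(Z :: point set) g r. spread_out Z g r \<Longrightarrow>
      (\<Sum>z | z \<in> Z \<and> (r z / (norm (g z))\<^sup>2) powr (\<alpha> / 2) < \<delta>. (r z / (norm (g z))\<^sup>2) powr (\<alpha> / 2)) \<le> 1 / 16"
    using small_terms_threshold[of "\<alpha> / 2" "1 / 16"] assms by auto
  show thesis
  proof (rule that[OF \<delta>])
    fix V :: "point set" assume fin: "finite V" and card: "2 \<le> card V"
    define c :: "point \<Rightarrow> point \<Rightarrow> real" where "c u v = 1 / dist u v powr \<alpha>" for u v
    define C where "C = (\<lambda>(u, v). c u v) ` {(u, v) \<in> V \<times> V. u \<noteq> v}"
    have "finite C"
      unfolding C_def by (rule finite_imageI, rule finite_subset[of _ "V \<times> V"]) (use fin in auto)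
    obtain m where m: "0 < m" "\<And>t. t \<in> C \<Longrightarrow> m \<le> t"
    proof (rule that)
      show "0 < Min (insert 1 C)"
        using \<open>finite C\<close> by (auto simp: C_def c_def)
      show "Min (insert 1 C) \<le> t" if "t \<in> C" for t
        using that \<open>finite C\<close> by simp
    qed
    \<comment> \<open>So small that \<open>\<theta> * x v \<ge> 1 / 8\<close> for two points \<open>v\<close> would force a coupling above \<open>1\<close>.\<close>
    define \<theta> where "\<theta> = sqrt m / 9"
    have "0 < \<theta>"
      using m by (simp add: \<theta>_def)
    obtain x where x_pos: "\<And>v. 0 < x v"
      and balanced: "\<And>v. v \<in> V \<Longrightarrow> \<theta> * x v + (\<Sum>u\<in>V - {v}. c v u * x v * x u) = 1"
      using balance[OF fin \<open>0 < \<theta>\<close>, of c] by (auto simp: c_def dist_commute)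
    let ?B = "coupling \<alpha> x"
    have B_eq: "?B u v = c u v * x u * x v" for u v
      by (simp add: coupling_def c_def)
    have B_nonneg: "0 \<le> ?B u v" for u v
      using x_pos by (rule coupling_nonneg)
    have row: "\<theta> * x v + (\<Sum>u\<in>V. ?B v u) = 1" if "v \<in> V" for v
      using balanced[OF that] fin that by (simp add: sum.remove[of V v "?B v"]) (simp add: B_eq)
    then have row_le: "(\<Sum>u\<in>V. ?B v u) \<le> 1" if "v \<in> V" for v
      using that x_pos \<open>0 < \<theta>\<close> by (smt (verit) mult_pos_pos)
    have B_le_1: "?B v u \<le> 1" if "v \<in> V" "u \<in> V" for u v
      using member_le_sum[of u V "?B v"] row_le[OF that(1)] B_nonneg fin that by fastforce
    define r where "r v = x v powr (2 / \<alpha>)" for v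
    have r_pos: "0 < r v" for v
      using x_pos[of v] by (simp add: r_def)
    have r_powr: "r v powr (\<alpha> / 2) = x v" for v
      using x_pos[of v] assms by (simp add: r_def powr_powr)
    have r_le: "r u * r v \<le> (dist u v)\<^sup>2" if "u \<in> V" "v \<in> V" "u \<noteq> v" for u v
    proof -
      have "x u * x v \<le> dist u v powr \<alpha>"
        using B_le_1[OF that(1,2)] that(3) by (simp add: coupling_def)
      then have "(x u * x v) powr (2 / \<alpha>) \<le> (dist u v powr \<alpha>) powr (2 / \<alpha>)"
        using x_pos assms by (intro powr_mono2) (auto simp: less_imp_le)
      then show ?thesis
        using x_pos assms that by (simp add: r_def powr_mult powr_powr less_imp_le)
    qed
    define b where "b v u = (if ?B v u < \<delta> then ?B v u else 0)" for v u
    have b_nonneg: "0 \<le> b v u" for u v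
      by (simp add: b_def B_nonneg)
    have b_commute: "b u v = b v u" for u v
      by (simp add: b_def coupling_commute)
    have upper: "(\<Sum>u\<in>V. if r v \<le> r u then b v u else 0) \<le> 1 / 16" if v: "v \<in> V" for v
    proof -
      define Z where "Z = {z \<in> V - {v}. r v \<le> r z}"
      have rescaled: "(r z / r v / (norm ((z - v) /\<^sub>R r v))\<^sup>2) powr (\<alpha> / 2) = ?B v z" if "z \<in> Z" for z
      proof -
        have "r z / r v / (norm ((z - v) /\<^sub>R r v))\<^sup>2 = r v * r z / (dist v z)\<^sup>2"
          unfolding norm_rescaled[OF r_pos]
          using r_pos[of v] by (simp add: power_divide power2_eq_square)
        also have "\<dots> powr (\<alpha> / 2) = r v powr (\<alpha> / 2) * r z powr (\<alpha> / 2) / ((dist v z)\<^sup>2) powr (\<alpha> / 2)"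
          using r_pos by (simp add: powr_divide powr_mult less_imp_le)
        also have "((dist v z)\<^sup>2) powr (\<alpha> / 2) = dist v z powr \<alpha>"
          using that by (simp add: Z_def powr_powr powr_numeral[symmetric] del: powr_numeral)
        finally show ?thesis
          by (simp add: r_powr coupling_def)
      qed
      have "(\<Sum>u\<in>V. if r v \<le> r u then b v u else 0) = (\<Sum>z | z \<in> Z \<and> ?B v z < \<delta>. ?B v z)"
        using fin by (intro sum.mono_neutral_cong_right) (auto simp: Z_def b_def)
      also have "\<dots> = (\<Sum>z | z \<in> Z \<and> (r z / r v / (norm ((z - v) /\<^sub>R r v))\<^sup>2) powr (\<alpha> / 2) < \<delta>.
                        (r z / r v / (norm ((z - v) /\<^sub>R r v))\<^sup>2) powr (\<alpha> / 2))"
        by (rule sum.cong) (auto simp only: rescaled mem_Collect_eq)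
      also have "\<dots> \<le> 1 / 16"
        unfolding Z_def by (intro small spread_out_rescaled fin v r_pos r_le)
      finally show ?thesis .
    qed
    \<comment> \<open>Each weak entry is charged to the row of its endpoint with the smaller
      \<open>r\<close>, the direction that \<open>upper\<close> controls; by symmetry the total is
      at most twice the charged sum.\<close>
    have "(\<Sum>v\<in>V. \<Sum>u\<in>V. b v u)
            \<le> (\<Sum>v\<in>V. \<Sum>u\<in>V. (if r v \<le> r u then b v u else 0) + (if r u \<le> r v then b u v else 0))"
      by (intro sum_mono) (auto simp: b_nonneg b_commute)
    also have "\<dots> = (\<Sum>v\<in>V. \<Sum>u\<in>V. if r v \<le> r u then b v u else 0)
                  + (\<Sum>v\<in>V. \<Sum>u\<in>V. if r u \<le> r v then b u v else 0)"
      by (simp add: sum.distrib)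
    also have "(\<Sum>v\<in>V. \<Sum>u\<in>V. if r u \<le> r v then b u v else 0) = (\<Sum>v\<in>V. \<Sum>u\<in>V. if r v \<le> r u then b v u else 0)"
      by (rule sum.swap)
    also have "(\<Sum>v\<in>V. \<Sum>u\<in>V. if r v \<le> r u then b v u else 0) + (\<Sum>v\<in>V. \<Sum>u\<in>V. if r v \<le> r u then b v u else 0)
                 \<le> real (card V) * (1 / 16) + real (card V) * (1 / 16)"
      by (intro add_mono sum_bounded_above upper)
    finally have total: "(\<Sum>v\<in>V. \<Sum>u\<in>V. b v u) \<le> real (card V) / 8"
      by simp
    define Good where "Good = {v \<in> V. \<exists>u\<in>V. \<delta> \<le> ?B v u}"
    define Loose where "Loose = {v \<in> V. 1 / 8 \<le> \<theta> * x v}"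
    define Bad where "Bad = V - Good - Loose"
    have "real (card Bad) * (7 / 8) \<le> (\<Sum>v\<in>Bad. \<Sum>u\<in>V. b v u)"
    proof (rule sum_bounded_below)
      fix v assume v: "v \<in> Bad"
      then have "(\<Sum>u\<in>V. b v u) = (\<Sum>u\<in>V. ?B v u)"
        by (intro sum.cong) (auto simp: Bad_def Good_def b_def)
      then show "7 / 8 \<le> (\<Sum>u\<in>V. b v u)"
        using row[of v] v by (auto simp: Bad_def Loose_def)
    qed
    also have "\<dots> \<le> (\<Sum>v\<in>V. \<Sum>u\<in>V. b v u)"
      using fin b_nonneg by (intro sum_mono2) (auto simp: Bad_def intro: sum_nonneg)
    finally have Bad: "real (card Bad) \<le> real (card V) / 7"
      using total by simp
    have "u = v" if "u \<in> Loose" "v \<in> Loose" for u v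
    proof (rule ccontr)
      assume "u \<noteq> v"
      have uv: "u \<in> V" "v \<in> V" "1 / 8 \<le> \<theta> * x u" "1 / 8 \<le> \<theta> * x v"
        using that by (auto simp: Loose_def)
      have "1 / 8 * (1 / 8) \<le> (\<theta> * x u) * (\<theta> * x v)"
        using uv by (intro mult_mono) auto
      also have "(\<theta> * x u) * (\<theta> * x v) = \<theta>\<^sup>2 * (x u * x v)"
        by (simp add: power2_eq_square mult_ac)
      \<comment> \<open>The 9 in \<open>\<theta>\<close> is chosen because \<open>1 / 64\<close>
        exceeds \<open>1 / 81\<close>.\<close>
      also have "\<theta>\<^sup>2 = m / 81"
        using m(1) by (simp add: \<theta>_def power_divide)
      finally have "1 < m * (x u * x v)"
        by simp
      also have "\<dots> \<le> c u v * (x u * x v)"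
        using m(2)[of "c u v"] uv \<open>u \<noteq> v\<close> x_pos
        by (intro mult_right_mono) (auto simp: C_def less_imp_le)
      finally show False
        using B_le_1[OF uv(1,2)] by (simp add: B_eq mult.assoc)
    qed
    then have "card Loose \<le> 1"
      using card_le_Suc0_iff_eq[of Loose] fin by (simp add: Loose_def)
    moreover have "card V \<le> card Good + (card Loose + card Bad)"
    proof -
      have "V \<subseteq> Good \<union> (Loose \<union> Bad)"
        by (auto simp: Bad_def)
      then have "card V \<le> card (Good \<union> (Loose \<union> Bad))"
        using fin by (intro card_mono) (auto simp: Bad_def Good_def Loose_def)
      then show ?thesis
        using card_Un_le[of Good "Loose \<union> Bad"] card_Un_le[of Loose Bad] by linarith
    qed
    \<comment> \<open>With at most one loose point and at most \<open>card V / 7\<close> bad ones,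
      \<open>6 / 7 * card V - 1\<close> points remain, which is at least \<open>card V / 3\<close>
      once \<open>card V\<close> is at least 2.\<close>
    ultimately have "real (card V) / 3 \<le> real (card Good)"
      using Bad card by linarith
    then show "\<exists>x. (\<forall>v. 0 < x v) \<and> (\<forall>v\<in>V. (\<Sum>u\<in>V. coupling \<alpha> x v u) \<le> 1) \<and>
                 real (card V) / 3 \<le> real (card {v \<in> V. \<exists>u\<in>V. \<delta> \<le> coupling \<alpha> x v u})"
      using x_pos row_le by (auto simp: Good_def)
  qed
qed

subsection \<open>Large feasible matchings\<close>

text \<open>A weighted analogue of finding a large independent set in a graph of bounded degree, by
  local optimality.\<close>

lemma sparse_subset:
  fixes W :: "'a \<Rightarrow> 'a \<Rightarrow> real"
  assumes fin: "finite E"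
    and W_nonneg: "\<And>e f. 0 \<le> W e f" and W_sym: "\<And>e f. W e f = W f e"
    and degree: "\<And>f. f \<in> E \<Longrightarrow> (\<Sum>e\<in>E. W f e) \<le> D"
  obtains S where "S \<subseteq> E" "\<And>e. e \<in> S \<Longrightarrow> (\<Sum>f\<in>S - {e}. W e f) \<le> \<epsilon>"
    and "\<epsilon> * real (card E) \<le> (D + \<epsilon>) * real (card S)"
proof -
  \<comment> \<open>At a maximum of \<open>\<Phi>\<close>, removing a member of \<open>S\<close> gives sparsity and adding a non-member gives size.\<close>
  define \<Phi> where "\<Phi> S = 2 * \<epsilon> * real (card S) - (\<Sum>e\<in>S. \<Sum>f\<in>S - {e}. W e f)" for S
  \<comment> \<open>By symmetry of \<open>W\<close>, a new member adds its row and an equal column,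
    hence the factor 2.\<close>
  have ins: "\<Phi> (insert e S) = \<Phi> S + 2 * (\<epsilon> - (\<Sum>f\<in>S. W e f))" if "finite S" "e \<notin> S" for e S
  proof -
    have "(\<Sum>a\<in>S. \<Sum>f\<in>insert e S - {a}. W a f) = (\<Sum>a\<in>S. W e a + (\<Sum>f\<in>S - {a}. W a f))"
    proof (rule sum.cong)
      fix a assume "a \<in> S"
      then have "insert e S - {a} = insert e (S - {a})"
        using that by auto
      then show "(\<Sum>f\<in>insert e S - {a}. W a f) = W e a + (\<Sum>f\<in>S - {a}. W a f)"
        using that W_sym[of a e] by simp
    qed simp
    then show ?thesis
      using that by (simp add: \<Phi>_def sum.distrib algebra_simps)
  qed
  obtain S where S: "S \<subseteq> E" and max: "\<And>T. T \<subseteq> E \<Longrightarrow> \<Phi> T \<le> \<Phi> S"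
  proof -
    have "finite (\<Phi> ` Pow E)"
      using fin by simp
    then have "Max (\<Phi> ` Pow E) \<in> \<Phi> ` Pow E" "\<forall>T\<in>Pow E. \<Phi> T \<le> Max (\<Phi> ` Pow E)"
      by (auto intro!: Max_in)
    then show thesis
      using that by (metis (no_types, lifting) Pow_iff imageE)
  qed
  have finS: "finite S"
    using S fin by (rule finite_subset)
  show thesis
  proof
    show "S \<subseteq> E" by fact
    show "(\<Sum>f\<in>S - {e}. W e f) \<le> \<epsilon>" if "e \<in> S" for e
      using ins[of "S - {e}" e] max[of "S - {e}"] that S finS by (auto simp: insert_absorb)
    \<comment> \<open>Double counting between \<open>S\<close> and its complement: every non-member
      sends weight at least \<open>\<epsilon>\<close> into \<open>S\<close>, while each member has
      total weight at most \<open>D\<close>.\<close>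
    have "real (card (E - S)) * \<epsilon> \<le> (\<Sum>e\<in>E - S. \<Sum>f\<in>S. W e f)"
    proof (rule sum_bounded_below)
      fix e assume "e \<in> E - S"
      then show "\<epsilon> \<le> (\<Sum>f\<in>S. W e f)"
        using ins[of S e] max[of "insert e S"] S finS by auto
    qed
    also have "\<dots> = (\<Sum>f\<in>S. \<Sum>e\<in>E - S. W f e)"
      by (subst sum.swap) (simp add: W_sym)
    also have "\<dots> \<le> (\<Sum>f\<in>S. \<Sum>e\<in>E. W f e)"
      using fin W_nonneg by (intro sum_mono sum_mono2) auto
    also have "\<dots> \<le> real (card S) * D"
      using S degree by (intro sum_bounded_above) auto
    finally show "\<epsilon> * real (card E) \<le> (D + \<epsilon>) * real (card S)"
      using S fin finS card_mono[OF fin S] by (simp add: card_Diff_subset of_nat_diff algebra_simps)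
  qed
qed

section \<open>From sparse sets of pairs to feasibility\<close>

lemma links_doubleton: "a \<noteq> b \<Longrightarrow> links {a, b} = {(a, b), (b, a)}"
  by (auto simp: links_def doubleton_eq_iff)

lemma sum_links:
  assumes "card l = 2"
  shows "(\<Sum>y\<in>links l. h (fst y)) = (\<Sum>u\<in>l. h u)"
proof -
  obtain a b where "l = {a, b}" "a \<noteq> b"
    using assms by (auto simp: card_2_iff)
  then show ?thesis
    by (simp add: links_doubleton)
qed

text \<open>The case \<open>b = 0\<close> is a receiver without interference: the ratio is infinite
  because \<open>a\<close> is positive.\<close>

lemma le_ennreal_divide:
  assumes "0 < a" "0 \<le> b" "0 \<le> \<beta>" "\<beta> * b \<le> a"
  shows "ennreal \<beta> \<le> ennreal a / ennreal b"
proof (cases "b = 0")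
  case True
  then show ?thesis
    using assms by (simp add: ennreal_divide_eq_top_iff top_unique[symmetric] ennreal_zero_less_divide)
next
  case False
  then show ?thesis
    using assms by (simp add: divide_ennreal ennreal_leI pos_le_divide_eq)
qed

text \<open>The power of a link is taken to depend on its sender only. Disjointness keeps every
  interfering sender away from the receiver, so the extended quotients agree with the real
  ones.\<close>

lemma feasibleI:
  fixes x :: "point \<Rightarrow> real"
  assumes fin: "finite S" and "0 \<le> \<beta>" and two: "\<And>l. l \<in> S \<Longrightarrow> card l = 2" and disj: "disjoint S"
    and pos: "\<And>v. 0 < x v"
    and sinr: "\<And>l s t. \<lbrakk>l \<in> S; l = {s, t}\<rbrakk> \<Longrightarrow>
      \<beta> * (\<Sum>l'\<in>S - {l}. \<Sum>u\<in>l'. x u / dist u t powr \<alpha>) \<le> x s / dist s t powr \<alpha>"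
  shows "feasible \<alpha> \<beta> S"
  unfolding feasible_def
proof (intro conjI exI[of _ "\<lambda>y. x (fst y)"] ballI)
  fix l y assume l: "l \<in> S" and "y \<in> links l"
  then obtain s t where y: "y = (s, t)" "s \<noteq> t" "l = {s, t}"
    by (auto simp: links_def)
  have "interference \<alpha> (\<lambda>y. x (fst y)) (S - {l}) y
          = (\<Sum>l'\<in>S - {l}. \<Sum>z\<in>links l'. ennreal (x (fst z) / dist (fst z) t powr \<alpha>))"
    unfolding interference_def
  proof (intro sum.cong refl)
    fix l' z assume l': "l' \<in> S - {l}" and "z \<in> links l'"
    then have "fst z \<in> l'"
      by (auto simp: links_def)
    moreover have "l \<inter> l' = {}"
      using disj l l' by (auto simp: disjoint_def)
    ultimately have "fst z \<noteq> t"
      using y by auto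
    then show "ennreal (x (fst z)) / ennreal (link_dist z y powr \<alpha>) = ennreal (x (fst z) / dist (fst z) t powr \<alpha>)"
      using y pos by (simp add: link_dist_def divide_ennreal less_imp_le)
  qed
  also have "\<dots> = (\<Sum>l'\<in>S - {l}. \<Sum>u\<in>l'. ennreal (x u / dist u t powr \<alpha>))"
    using two by (intro sum.cong refl sum_links[where h = "\<lambda>u. ennreal (x u / dist u t powr \<alpha>)"]) auto
  also have "\<dots> = ennreal (\<Sum>l'\<in>S - {l}. \<Sum>u\<in>l'. x u / dist u t powr \<alpha>)"
    using pos by (simp add: sum_ennreal sum_nonneg less_imp_le)
  finally have interference: "interference \<alpha> (\<lambda>y. x (fst y)) (S - {l}) y
    = ennreal (\<Sum>l'\<in>S - {l}. \<Sum>u\<in>l'. x u / dist u t powr \<alpha>)" .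
  have "signal \<alpha> (\<lambda>y. x (fst y)) y = ennreal (x s / dist s t powr \<alpha>)"
    using y pos by (simp add: signal_def link_length_def divide_ennreal less_imp_le)
  then show "ennreal \<beta> \<le> signal \<alpha> (\<lambda>y. x (fst y)) y / interference \<alpha> (\<lambda>y. x (fst y)) (S - {l}) y"
    unfolding interference using y pos \<open>0 \<le> \<beta>\<close> sinr[OF l y(3)]
    by (auto intro!: le_ennreal_divide sum_nonneg simp: less_imp_le)
qed (use fin pos in auto)

lemma large_feasible_matching:
  fixes \<alpha> \<beta> :: real
  assumes "2 < \<alpha>" "1 \<le> \<beta>"
  obtains \<kappa> where "0 < \<kappa>" "\<kappa> < 1"
    and "\<And>V. \<lbrakk>finite V; 2 \<le> card V\<rbrakk> \<Longrightarrow>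
           \<exists>S \<subseteq> pairs V. feasible \<alpha> \<beta> S \<and> disjoint S \<and> \<kappa> * real (card V) \<le> real (card S)"
proof -
  obtain \<delta> where \<delta>: "0 < \<delta>" "\<delta> < 1"
    and coupled: "\<And>V. \<lbrakk>finite V; 2 \<le> card V\<rbrakk> \<Longrightarrow> \<exists>x. (\<forall>v. 0 < x v) \<and>
           (\<forall>v\<in>V. (\<Sum>u\<in>V. coupling \<alpha> x v u) \<le> 1) \<and>
           real (card V) / 3 \<le> real (card {v \<in> V. \<exists>u\<in>V. \<delta> \<le> coupling \<alpha> x v u})"
    using many_strongly_coupled[OF assms(1)] by blast
  \<comment> \<open>Interference of at most \<open>\<epsilon>\<close> in coupling units against a
    signal of at least \<open>\<delta>\<close> gives the ratio \<open>\<beta>\<close>.\<close>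
  define \<epsilon> where "\<epsilon> = \<delta> / \<beta>"
  have \<epsilon>: "0 < \<epsilon>" "\<epsilon> < 1" "\<beta> * \<epsilon> = \<delta>"
    using \<delta> assms by (auto simp: \<epsilon>_def divide_simps)
  \<comment> \<open>This combines the fraction \<open>\<epsilon> / (D + \<epsilon>)\<close> from
    \<open>sparse_subset\<close> at \<open>D = 4 / \<delta>\<close> with a lower bound
    \<open>card V / 6\<close> on the number of strong pairs.\<close>
  define \<kappa> where "\<kappa> = \<epsilon> / (6 * (4 / \<delta> + \<epsilon>))"
  have denom: "0 < 4 / \<delta> + \<epsilon>"
    using \<delta> \<epsilon> by (simp add: add_pos_pos)
  show thesis
  proof (rule that)
    show "0 < \<kappa>"
      using denom \<epsilon> by (simp add: \<kappa>_def)
    have "\<epsilon> < 6 * (4 / \<delta> + \<epsilon>)"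
      using divide_pos_pos[of 4 \<delta>] \<delta>(1) \<epsilon>(1) by argo
    then show "\<kappa> < 1"
      using denom by (simp add: \<kappa>_def)
    fix V :: "point set" assume fin: "finite V" and "2 \<le> card V"
    from coupled[OF this] obtain x where x_pos: "\<And>v. 0 < x v"
      and row: "\<And>v. v \<in> V \<Longrightarrow> (\<Sum>u\<in>V. coupling \<alpha> x v u) \<le> 1"
      and many: "real (card V) / 3 \<le> real (card {v \<in> V. \<exists>u\<in>V. \<delta> \<le> coupling \<alpha> x v u})"
      by blast
    let ?B = "coupling \<alpha> x"
    define E where "E = {{u, v} | u v. u \<in> V \<and> v \<in> V \<and> \<delta> \<le> ?B u v}"
    \<comment> \<open>The diagonal entries \<open>1\<close> force a sparse set of pairs to be disjoint.\<close>
    define K where "K u v = of_bool (u = v) + ?B u v" for u v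
    define W where "W e f = (\<Sum>u\<in>e. \<Sum>v\<in>f. K u v)" for e f
    have B_nonneg: "0 \<le> ?B u v" for u v
      using x_pos by (rule coupling_nonneg)
    have K_nonneg: "0 \<le> K u v" for u v
      by (simp add: K_def B_nonneg)
    have K_commute: "K u v = K v u" for u v
      by (auto simp: K_def coupling_commute)
    have W_nonneg: "0 \<le> W e f" for e f
      by (simp add: W_def K_nonneg sum_nonneg)
    have W_commute: "W e f = W f e" for e f
      unfolding W_def by (subst sum.swap) (intro sum.cong refl K_commute)
    have E_pairs: "E \<subseteq> pairs V"
    proof
      fix e assume "e \<in> E"
      then obtain u v where e: "e = {u, v}" "u \<in> V" "v \<in> V" "\<delta> \<le> ?B u v"
        by (auto simp: E_def)
      moreover have "u \<noteq> v"
        using e(4) \<delta>(1) by auto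
      ultimately show "e \<in> pairs V"
        by (simp add: pairs_def)
    qed
    have finE: "finite E"
      by (rule finite_subset[of _ "Pow V"]) (use fin E_pairs in \<open>auto simp: pairs_def\<close>)
    have E_sub: "e \<subseteq> V" and E_card: "card e = 2" if "e \<in> E" for e
      using that E_pairs by (auto simp: pairs_def)
    have E_fin: "finite e" if "e \<in> E" for e
      using E_sub[OF that] fin by (rule finite_subset)
    have E_strong: "\<delta> \<le> ?B s t" if st: "{s, t} \<in> E" for s t
    proof -
      obtain u v where "{s, t} = {u, v}" "\<delta> \<le> ?B u v"
        using st unfolding E_def mem_Collect_eq by iprover
      then show ?thesis
        using coupling_commute[of \<alpha> x u v] by (auto simp only: doubleton_eq_iff)
    qed
    have K_row: "(\<Sum>v\<in>V. K u v) \<le> 2" if "u \<in> V" for u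
    proof -
      have "(\<Sum>v\<in>V. of_bool (u = v)) = (1::real)"
        using that fin by (simp add: of_bool_def)
      then show ?thesis
        using row[OF that] by (simp add: K_def sum.distrib)
    qed
    \<comment> \<open>A row of sum at most 1 has at most \<open>1 / \<delta>\<close> entries of size
      \<open>\<delta>\<close> or more.\<close>
    have deg: "real (card {e \<in> E. v \<in> e}) \<le> 1 / \<delta>" if v: "v \<in> V" for v
    proof -
      have "{e \<in> E. v \<in> e} \<subseteq> (\<lambda>u. {v, u}) ` {u \<in> V. \<delta> \<le> ?B v u}"
      proof
        fix e assume e: "e \<in> {e \<in> E. v \<in> e}"
        then obtain a b where "e = {a, b}" "v \<in> {a, b}"
          by (auto simp: E_def)
        then obtain u where u: "e = {v, u}"
          by (auto simp: insert_commute)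
        then have "u \<in> V" "\<delta> \<le> ?B v u"
          using e E_sub[of e] E_strong[of v u] by auto
        with u show "e \<in> (\<lambda>u. {v, u}) ` {u \<in> V. \<delta> \<le> ?B v u}"
          by simp
      qed
      then have "card {e \<in> E. v \<in> e} \<le> card {u \<in> V. \<delta> \<le> ?B v u}"
        using fin by (intro surj_card_le) auto
      then have "real (card {e \<in> E. v \<in> e}) * \<delta> \<le> real (card {u \<in> V. \<delta> \<le> ?B v u}) * \<delta>"
        using \<delta> by (intro mult_right_mono) auto
      also have "\<dots> \<le> (\<Sum>u | u \<in> V \<and> \<delta> \<le> ?B v u. ?B v u)"
        by (intro sum_bounded_below) auto
      also have "\<dots> \<le> (\<Sum>u\<in>V. ?B v u)"
        using fin B_nonneg by (intro sum_mono2) auto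
      finally show ?thesis
        using row[OF v] \<delta> by (simp add: pos_le_divide_eq)
    qed
    \<comment> \<open>Each of the two endpoints of \<open>f\<close> has a \<open>K\<close>-row of
      sum at most 2, and each point is counted once per strong pair containing it, at most
      \<open>1 / \<delta>\<close> times.\<close>
    have degree: "(\<Sum>e\<in>E. W f e) \<le> 4 / \<delta>" if f: "f \<in> E" for f
    proof -
      have "(\<Sum>e\<in>E. \<Sum>v\<in>e. K u v) \<le> 2 / \<delta>" if u: "u \<in> V" for u
      proof -
        have "(\<Sum>e\<in>E. \<Sum>v\<in>e. K u v) = (\<Sum>e\<in>E. \<Sum>v | v \<in> V \<and> v \<in> e. K u v)"
          using E_sub by (intro sum.cong) auto
        also have "\<dots> = (\<Sum>v\<in>V. \<Sum>e | e \<in> E \<and> v \<in> e. K u v)"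
          by (rule sum.swap_restrict[OF finE fin])
        also have "\<dots> = (\<Sum>v\<in>V. real (card {e \<in> E. v \<in> e}) * K u v)"
          by simp
        also have "\<dots> \<le> (\<Sum>v\<in>V. 1 / \<delta> * K u v)"
          using deg K_nonneg by (intro sum_mono mult_right_mono) auto
        also have "\<dots> = 1 / \<delta> * (\<Sum>v\<in>V. K u v)"
          by (simp add: sum_distrib_left)
        also have "\<dots> \<le> 1 / \<delta> * 2"
          using K_row[OF u] \<delta> by (intro mult_left_mono) auto
        finally show ?thesis
          by simp
      qed
      then have "(\<Sum>u\<in>f. \<Sum>e\<in>E. \<Sum>v\<in>e. K u v) \<le> real (card f) * (2 / \<delta>)"
        using E_sub[OF f] by (intro sum_bounded_above) auto
      moreover have "(\<Sum>e\<in>E. W f e) = (\<Sum>u\<in>f. \<Sum>e\<in>E. \<Sum>v\<in>e. K u v)"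
        unfolding W_def by (rule sum.swap)
      ultimately show ?thesis
        using E_card[OF f] by simp
    qed
    obtain S where S: "S \<subseteq> E" and sparse: "\<And>e. e \<in> S \<Longrightarrow> (\<Sum>f\<in>S - {e}. W e f) \<le> \<epsilon>"
      and large: "\<epsilon> * real (card E) \<le> (4 / \<delta> + \<epsilon>) * real (card S)"
      using sparse_subset[of E W "4 / \<delta>" \<epsilon>, OF finE W_nonneg W_commute degree] by blast
    have finS: "finite S"
      using S finE by (rule finite_subset)
    have "disjoint S"
    proof (rule disjointI, rule ccontr)
      fix e f assume ef: "e \<in> S" "f \<in> S" "e \<noteq> f" "e \<inter> f \<noteq> {}"
      then obtain v where v: "v \<in> e" "v \<in> f"
        by blast
      have "1 \<le> K v v"
        by (simp add: K_def)
      also have "\<dots> \<le> (\<Sum>u\<in>f. K v u)"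
        using v ef S E_fin K_nonneg by (intro member_le_sum) auto
      also have "\<dots> \<le> W e f"
        unfolding W_def using v ef S E_fin K_nonneg
        by (intro member_le_sum[of v e "\<lambda>v. \<Sum>u\<in>f. K v u"] sum_nonneg) auto
      also have "\<dots> \<le> (\<Sum>f\<in>S - {e}. W e f)"
        using ef finS W_nonneg by (intro member_le_sum) auto
      also have "\<dots> \<le> \<epsilon>"
        using ef by (intro sparse)
      finally show False
        using \<epsilon> by simp
    qed
    moreover have "feasible \<alpha> \<beta> S"
    proof (rule feasibleI[OF finS _ _ \<open>disjoint S\<close>, of \<beta> x \<alpha>])
      fix l s t assume l: "l \<in> S" "l = {s, t}"
      define I where "I = (\<Sum>l'\<in>S - {l}. \<Sum>u\<in>l'. x u / dist u t powr \<alpha>)"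
      \<comment> \<open>Multiplying by the receiver's own \<open>x t\<close> turns received powers
        into couplings; this factor is cancelled at the end.\<close>
      have "I * x t = (\<Sum>l'\<in>S - {l}. \<Sum>u\<in>l'. ?B t u)"
        unfolding I_def sum_distrib_right by (simp add: coupling_def dist_commute mult.commute)
      also have "\<dots> \<le> (\<Sum>l'\<in>S - {l}. W l l')"
      proof (rule sum_mono)
        fix l' assume l': "l' \<in> S - {l}"
        have "(\<Sum>u\<in>l'. ?B t u) \<le> (\<Sum>u\<in>l'. K t u)"
          by (intro sum_mono) (simp add: K_def)
        also have "\<dots> \<le> W l l'"
          unfolding W_def using l S E_fin K_nonneg
          by (intro member_le_sum[of t l "\<lambda>v. \<Sum>u\<in>l'. K v u"] sum_nonneg) auto
        finally show "(\<Sum>u\<in>l'. ?B t u) \<le> W l l'" .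
      qed
      also have "\<dots> \<le> \<epsilon>"
        using l by (intro sparse)
      finally have "\<beta> * (I * x t) \<le> \<beta> * \<epsilon>"
        using assms by (intro mult_left_mono) auto
      also have "\<dots> \<le> ?B s t"
        using E_strong[of s t] l S \<epsilon>(3) by auto
      finally have "(\<beta> * I) * x t \<le> (x s / dist s t powr \<alpha>) * x t"
        by (simp add: coupling_def mult.assoc)
      then show "\<beta> * (\<Sum>l'\<in>S - {l}. \<Sum>u\<in>l'. x u / dist u t powr \<alpha>) \<le> x s / dist s t powr \<alpha>"
        using x_pos[of t] by (simp only: I_def mult_le_cancel_right)
    qed (use S E_card x_pos assms in auto)
    moreover have "\<kappa> * real (card V) \<le> real (card S)"
    proof -
      \<comment> \<open>The pairs in \<open>E\<close> cover at least \<open>card V / 3\<close>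
        points, two at a time.\<close>
      have "{v \<in> V. \<exists>u\<in>V. \<delta> \<le> ?B v u} \<subseteq> \<Union>E"
        by (auto simp: E_def)
      then have "card {v \<in> V. \<exists>u\<in>V. \<delta> \<le> ?B v u} \<le> card (\<Union>E)"
        using finE E_fin by (intro card_mono) auto
      also have "\<dots> \<le> (\<Sum>e\<in>E. card e)"
        by (rule card_Union_le_sum_card)
      also have "\<dots> = 2 * card E"
        using E_card by simp
      finally have "real (card V) / 6 \<le> real (card E)"
        using many by linarith
      then have "\<epsilon> * (real (card V) / 6) \<le> (4 / \<delta> + \<epsilon>) * real (card S)"
        using large \<epsilon>(1) mult_left_mono[of "real (card V) / 6" "real (card E)" \<epsilon>] by linarith
      then show ?thesis
        using denom by (simp add: \<kappa>_def divide_simps mult_ac)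
    qed
    ultimately show "\<exists>S \<subseteq> pairs V. feasible \<alpha> \<beta> S \<and> disjoint S \<and> \<kappa> * real (card V) \<le> real (card S)"
      using S E_pairs by blast
  qed
qed

subsection \<open>Connecting by successive matchings\<close>

text \<open>In each pair \<open>g e\<close> will be dropped and \<open>h e\<close> kept;
  disjointness prevents a kept point from being dropped by another pair.\<close>

lemma exists_representatives:
  assumes "disjoint S" and "\<And>e. e \<in> S \<Longrightarrow> card e = 2"
  obtains g h where "inj_on g S" "\<And>e. e \<in> S \<Longrightarrow> {g e, h e} = e" "\<And>e. e \<in> S \<Longrightarrow> h e \<notin> g ` S"
proof -
  have "\<forall>e\<in>S. \<exists>p. {fst p, snd p} = e \<and> fst p \<noteq> snd p"
    using assms(2) by (fastforce simp: card_2_iff)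
  then obtain p where p: "\<And>e. e \<in> S \<Longrightarrow> {fst (p e), snd (p e)} = e" "\<And>e. e \<in> S \<Longrightarrow> fst (p e) \<noteq> snd (p e)"
    by metis
  have mem: "fst (p e) \<in> e" "snd (p e) \<in> e" if "e \<in> S" for e
    using p(1)[OF that] by blast+
  have eq: "e = f" if "e \<in> S" "f \<in> S" "v \<in> e" "v \<in> f" for e f v
    using that assms(1) by (auto simp: disjoint_def)
  show thesis
  proof (rule that)
    show "inj_on (\<lambda>e. fst (p e)) S"
      by (rule inj_onI) (metis eq mem(1))
    show "{fst (p e), snd (p e)} = e" if "e \<in> S" for e
      using that by (rule p(1))
    show "snd (p e) \<notin> (\<lambda>e. fst (p e)) ` S" if "e \<in> S" for e
    proof
      assume "snd (p e) \<in> (\<lambda>e. fst (p e)) ` S"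
      then obtain f where "f \<in> S" "snd (p e) = fst (p f)"
        by blast
      then show False
        using that eq[of e f "snd (p e)"] mem p(2)[of e] by metis
    qed
  qed
qed

text \<open>Every added point is joined in both directions to a point of \<open>V'\<close>, so a
  walk goes from \<open>u\<close> into \<open>V'\<close>, through \<open>V'\<close>, and out to
  \<open>v\<close>.\<close>

lemma strongly_connected_link_graph_extend:
  assumes conn: "strongly_connected (link_graph V' L')" and "V' \<subseteq> V" "L' \<subseteq> L"
    and pendant: "\<And>v. v \<in> V - V' \<Longrightarrow> \<exists>h\<in>V'. v \<noteq> h \<and> {v, h} \<in> L"
  shows "strongly_connected (link_graph V L)"
proof -
  define A where "A = (\<Union>l\<in>L. links l)"
  have ends: "arcs_ends (link_graph W M) = (\<Union>l\<in>M. links l)" for W M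
    by (simp add: arcs_ends_conv link_graph_def)
  have reach: "u \<rightarrow>\<^sup>*\<^bsub>link_graph V L\<^esub> v \<longleftrightarrow> (u, v) \<in> rtrancl_on V A" for u v
    unfolding reachable_def ends A_def by (simp add: link_graph_def)
  have old: "(u, v) \<in> rtrancl_on V A" if "u \<in> V'" "v \<in> V'" for u v
  proof (rule rtrancl_on_mono)
    show "(u, v) \<in> rtrancl_on V' (\<Union>l\<in>L'. links l)"
      using conn that unfolding strongly_connected_def reachable_def ends by (simp add: link_graph_def)
  qed (use \<open>V' \<subseteq> V\<close> \<open>L' \<subseteq> L\<close> in \<open>auto simp: A_def\<close>)
  have hook: "\<exists>h\<in>V'. (v, h) \<in> rtrancl_on V A \<and> (h, v) \<in> rtrancl_on V A" if v: "v \<in> V" for v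
  proof (cases "v \<in> V'")
    case True
    then show ?thesis
      using old by blast
  next
    case False
    then obtain h where h: "h \<in> V'" "v \<noteq> h" "{v, h} \<in> L"
      using pendant v by blast
    then have "(v, h) \<in> A" "(h, v) \<in> A"
      by (auto simp: A_def links_def insert_commute intro!: bexI[of _ "{v, h}"])
    then have "(v, h) \<in> rtrancl_on V A" "(h, v) \<in> rtrancl_on V A"
      using h v \<open>V' \<subseteq> V\<close> by (auto intro: rtrancl_on_into_rtrancl_on[OF rtrancl_on_refl])
    then show ?thesis
      using h by blast
  qed
  show ?thesis
    unfolding strongly_connected_def reach
  proof (intro conjI ballI)
    show "verts (link_graph V L) \<noteq> {}"
      using conn \<open>V' \<subseteq> V\<close> by (auto simp: strongly_connected_def link_graph_def)
    fix u v assume "u \<in> verts (link_graph V L)" "v \<in> verts (link_graph V L)"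
    then obtain h k where "h \<in> V'" "k \<in> V'" "(u, h) \<in> rtrancl_on V A" "(k, v) \<in> rtrancl_on V A"
      using hook[of u] hook[of v] by (auto simp: link_graph_def)
    then show "(u, v) \<in> rtrancl_on V A"
      using old[of h k] by (blast intro: rtrancl_on_trans)
  qed
qed

lemma connectable_in_mono: "\<lbrakk>connectable_in \<alpha> \<beta> V j; j \<le> k\<rbrakk> \<Longrightarrow> connectable_in \<alpha> \<beta> V k"
  unfolding connectable_in_def by (meson order_trans)

text \<open>One round of the recursion: \<open>S\<close> fills a new slot, and the pairs of
  \<open>S\<close> attach each dropped endpoint to its kept partner.\<close>

lemma connectable_in_Suc:
  assumes "finite V" and S: "S \<subseteq> pairs V" "disjoint S" "S \<noteq> {}" "feasible \<alpha> \<beta> S"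
  obtains V' where "V' \<subseteq> V" "V' \<noteq> {}" "card V' + card S = card V"
    and "\<And>k. connectable_in \<alpha> \<beta> V' k \<Longrightarrow> connectable_in \<alpha> \<beta> V (Suc k)"
proof -
  have "\<And>e. e \<in> S \<Longrightarrow> card e = 2"
    using S(1) by (auto simp: pairs_def)
  from exists_representatives[OF S(2) this] obtain g h where inj: "inj_on g S"
    and gh: "\<And>e. e \<in> S \<Longrightarrow> {g e, h e} = e" and h: "\<And>e. e \<in> S \<Longrightarrow> h e \<notin> g ` S"
    by blast
  define V' where "V' = V - g ` S"
  have "e \<subseteq> V" if "e \<in> S" for e
    using that S(1) by (auto simp: pairs_def)
  then have gV: "g e \<in> V" and hV': "h e \<in> V'" if "e \<in> S" for e
    using that gh[OF that] h[OF that] unfolding V'_def by blast+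
  show thesis
  proof
    show "V' \<subseteq> V"
      by (auto simp: V'_def)
    show "V' \<noteq> {}"
      using S(3) hV' by blast
    have "g ` S \<subseteq> V"
      using gV by blast
    then show "card V' + card S = card V"
      using \<open>finite V\<close> inj card_mono[of V "g ` S"]
      by (simp add: V'_def card_Diff_subset finite_subset card_image)
    fix k assume "connectable_in \<alpha> \<beta> V' k"
    then obtain L P where L: "L \<subseteq> pairs V'" "strongly_connected (link_graph V' L)"
      and P: "partition_on L P" "card P \<le> k" "\<forall>S\<in>P. feasible \<alpha> \<beta> S"
      by (auto simp: connectable_in_def)
    \<comment> \<open>A pair of \<open>S\<close> contains a dropped point, so it cannot recur among
      the pairs on \<open>V'\<close>; hence \<open>S\<close> is a genuinely new block of the
      partition.\<close>
    have "e \<notin> L" if "e \<in> S" for e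
    proof
      assume "e \<in> L"
      then have "e \<subseteq> V'"
        using L(1) by (auto simp: pairs_def)
      then show False
        using gh[OF that] that by (auto simp: V'_def)
    qed
    then have "S \<union> L - S = L" "disjnt S (\<Union>P)"
      using partition_onD1[OF P(1)] by (auto simp: disjnt_def)
    then have "partition_on (S \<union> L) (insert S P)"
      using P(1) S(3) by (simp add: partition_on_insert)
    moreover have "card (insert S P) \<le> Suc k"
      using P(2) card_insert_le_m1[of "Suc k" P S] by simp
    moreover have "S \<union> L \<subseteq> pairs V"
      using S(1) L(1) by (auto simp: pairs_def V'_def)
    moreover have "strongly_connected (link_graph V (S \<union> L))"
    proof (rule strongly_connected_link_graph_extend[OF L(2)])
      fix v assume "v \<in> V - V'"
      then obtain e where "e \<in> S" "v = g e"
        by (auto simp: V'_def)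
      then show "\<exists>h\<in>V'. v \<noteq> h \<and> {v, h} \<in> S \<union> L"
        using gh[of e] h[of e] hV'[of e] by (intro bexI[of _ "h e"]) (metis UnI1 imageI)+
    qed (auto simp: V'_def)
    ultimately show "connectable_in \<alpha> \<beta> V (Suc k)"
      unfolding connectable_in_def using P(3) S(4) by (intro exI[of _ "S \<union> L"] exI[of _ "insert S P"]) auto
  qed
qed

lemma connectable_in_singleton: "connectable_in \<alpha> \<beta> {v} 0"
  unfolding connectable_in_def
  by (intro exI[of _ "{}"] conjI)
     (auto simp: partition_on_empty strongly_connected_def link_graph_def reachable_def)

text \<open>A round costs one slot and shrinks the point set by the factor
  \<open>1 - \<kappa>\<close> or better, so the bound drops by at least 1. It reaches 0 at a single
  point, where zero slots suffice.\<close>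

lemma connectable_in_logarithmic:
  assumes "0 < \<kappa>" "\<kappa> < 1"
    and matching: "\<And>V. \<lbrakk>finite V; 2 \<le> card V\<rbrakk> \<Longrightarrow>
      \<exists>S \<subseteq> pairs V. feasible \<alpha> \<beta> S \<and> disjoint S \<and> \<kappa> * real (card V) \<le> real (card S)"
    and "finite V" "V \<noteq> {}"
  shows "\<exists>k. real k \<le> ln (real (card V)) / - ln (1 - \<kappa>) \<and> connectable_in \<alpha> \<beta> V k"
  using \<open>finite V\<close> \<open>V \<noteq> {}\<close>
proof (induction "card V" arbitrary: V rule: less_induct)
  case less
  show ?case
  proof (cases "card V = 1")
    case True
    then show ?thesis
      using connectable_in_singleton by (auto simp: card_1_singleton_iff intro!: exI[of _ 0])
  next
    case False
    moreover have "0 < card V"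
      using less.prems by (simp add: card_gt_0_iff)
    ultimately have two: "2 \<le> card V"
      by linarith
    then obtain S where S: "S \<subseteq> pairs V" "disjoint S" "feasible \<alpha> \<beta> S" "\<kappa> * real (card V) \<le> real (card S)"
      using matching[OF less.prems(1)] by blast
    have "0 < \<kappa> * real (card V)"
      using two assms by simp
    then have "0 < card S"
      using S(4) by linarith
    then have "S \<noteq> {}"
      by auto
    from connectable_in_Suc[OF less.prems(1) S(1,2) this S(3)] obtain V'
      where V': "V' \<subseteq> V" "V' \<noteq> {}" "card V' + card S = card V"
        and step: "\<And>k. connectable_in \<alpha> \<beta> V' k \<Longrightarrow> connectable_in \<alpha> \<beta> V (Suc k)"
      by blast
    have finV': "finite V'"
      using V'(1) less.prems(1) by (rule finite_subset)
    have "card V' < card V"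
      using V'(3) \<open>0 < card S\<close> by linarith
    from less.hyps[OF this finV' V'(2)] obtain k
      where k: "real k \<le> ln (real (card V')) / - ln (1 - \<kappa>)" "connectable_in \<alpha> \<beta> V' k"
      by blast
    have neg: "ln (1 - \<kappa>) < 0"
      using assms by simp
    have "real (card V') \<le> (1 - \<kappa>) * real (card V)"
      using S(4) V'(3) by (simp add: algebra_simps flip: V'(3))
    then have "ln (real (card V')) \<le> ln ((1 - \<kappa>) * real (card V))"
      using V'(2) finV' by (intro ln_mono) (auto simp: card_gt_0_iff)
    also have "\<dots> = ln (1 - \<kappa>) + ln (real (card V))"
      using assms two by (simp add: ln_mult)
    finally have "ln (real (card V')) / - ln (1 - \<kappa>) \<le> (ln (1 - \<kappa>) + ln (real (card V))) / - ln (1 - \<kappa>)"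
      using neg by (intro divide_right_mono) auto
    also have "\<dots> = ln (real (card V)) / - ln (1 - \<kappa>) - 1"
      using neg by (simp add: add_divide_distrib)
    finally have "real (Suc k) \<le> ln (real (card V)) / - ln (1 - \<kappa>)"
      using k(1) by simp
    then show ?thesis
      using step[OF k(2)] by blast
  qed
qed

theorem theorem5:
  fixes \<alpha> \<beta> :: real
  assumes "\<alpha> > 2" and "\<beta> \<ge> 1"
  shows "\<exists>T :: nat \<Rightarrow> nat.
           (\<lambda>n. real (T n)) \<in> O(\<lambda>n. ln (real n)) \<and>
           (\<forall>V :: point set. finite V \<and> V \<noteq> {} \<longrightarrow> connectable_in \<alpha> \<beta> V (T (card V)))"
proof -
  obtain \<kappa> where \<kappa>: "0 < \<kappa>" "\<kappa> < 1"
    and matching: "\<And>V. \<lbrakk>finite V; 2 \<le> card V\<rbrakk> \<Longrightarrow>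
      \<exists>S \<subseteq> pairs V. feasible \<alpha> \<beta> S \<and> disjoint S \<and> \<kappa> * real (card V) \<le> real (card S)"
    using large_feasible_matching[OF assms] by blast
  define c where "c = - ln (1 - \<kappa>)"
  have c: "0 < c"
    using \<kappa> by (simp add: c_def)
  \<comment> \<open>The real bound depends only on \<open>card V\<close>, and rounding it down is
    harmless because the number of slots is an integer.\<close>
  define T where "T n = nat \<lfloor>ln (real n) / c\<rfloor>" for n
  have "(\<lambda>n. real (T n)) \<in> O(\<lambda>n. ln (real n))"
  proof (rule bigoI[of _ "1 / c"])
    show "\<forall>\<^sub>F n in sequentially. norm (real (T n)) \<le> 1 / c * norm (ln (real n))"
      using eventually_ge_at_top[of 1]
    proof eventually_elim
      case (elim n)
      then have "0 \<le> ln (real n) / c"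
        using c by simp
      then show ?case
        using elim by (simp add: T_def)
    qed
  qed
  moreover have "connectable_in \<alpha> \<beta> V (T (card V))" if V: "finite V" "V \<noteq> {}" for V
  proof -
    obtain k where k: "real k \<le> ln (real (card V)) / c" "connectable_in \<alpha> \<beta> V k"
      using connectable_in_logarithmic[OF \<kappa> matching V] by (auto simp: c_def)
    from k(1) have "k \<le> T (card V)"
      unfolding T_def by (simp add: le_nat_floor)
    with k(2) show ?thesis
      by (rule connectable_in_mono)
  qed
  ultimately show ?thesis
    by blast
qed

end
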